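(* For every integral polymatroid rank function $r:2^{[d]}\to\mathbb N$ and every activity vector $\boldsymbol\lambda\in\mathbb R_{>0}^d$, the probability measure $\mu_{r,\boldsymbol\lambda}$ on $\mathbb N^d$ defined by $$\mu_{r,\boldsymbol\lambda}(\mathbf n)\propto\frac{\boldsymbol\lambda^{\mathbf n}}{\mathbf n!},\qquad\mathbf n\in P_r,$$ (and $0$ off $P_r$) is ULC.
   Context: $\mathbb N=\{0,1,2,\dots\}$, $[d]=\{1,\dots,d\}$, $\mathbf e_i$ is the $i$-th standard basis vector, $\mathbf n!=\prod_i n_i!$, $\boldsymbol\lambda^{\mathbf n}=\prod_i\lambda_i^{n_i}$. An integral polymatroid rank function on $[d]$ is a map $r:2^{[d]}\to\mathbb N$ with $r(\varnothing)=0$; $r(S)\le r(T)$ whenever $S\subseteq T\subseteq[d]$; and $r(S)+r(T)\ge r(S\cup T)+r(S\cap T)$ for all $S,T\subseteq[d]$. Its discrete polymatroid is $P_r=\{\mathbf n\in\mathbb N^d:\ \sum_{i\in S}n_i\le r(S)\ \text{for all }S\subseteq[d]\}$, a finite set. ULC: a set $S\subseteq\mathbb N^d$ is downward closed if $\mathbf n\in S$ and $\mathbf 0\le\mathbf m\le\mathbf n$ (coordinatewise) imply $\mathbf m\in S$. A probability measure $\mu$ on $\mathbb N^d$ with downward closed support is ULC if, with $a(\mathbf n)=\mathbf n!\,\mu(\mathbf n)$ and $\mathcal I_{\mathbf n}=\{i\in[d]:\mathbf n+\mathbf e_i\in\mathrm{supp}(\mu)\}$, the matrix $\big(1-\frac{a(\mathbf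 n)a(\mathbf n+\mathbf e_i+\mathbf e_j)}{a(\mathbf n+\mathbf e_i)a(\mathbf n+\mathbf e_j)}\big)_{i,j\in\mathcal I_{\mathbf n}}$ is positive semidefinite for every $\mathbf n\in\mathrm{supp}(\mu)$. *)

theory Defs
  imports "HOL-Probability.Probability"
begin

text \<open>
  The finite type \<open>'d\<close> plays the role of \<open>[d]\<close>, so \<open>nat ^ 'd\<close> is \<open>\<nat>\<^sup>d\<close> with the library's
  componentwise addition and order, and \<open>axis i 1\<close> is the \<open>i\<close>-th standard basis vector.
\<close>

definition polymatroid_rank :: "('d::finite set \<Rightarrow> nat) \<Rightarrow> bool" where
  "polymatroid_rank r \<longleftrightarrow>
     r {} = 0 \<and>
     (\<forall>S T. S \<subseteq> T \<longrightarrow> r S \<le> r T) \<and>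
     (\<forall>S T. r (S \<union> T) + r (S \<inter> T) \<le> r S + r T)"

definition discrete_polymatroid :: "('d::finite set \<Rightarrow> nat) \<Rightarrow> (nat ^ 'd) set" where
  "discrete_polymatroid r = {n. \<forall>S. (\<Sum>i\<in>S. n $ i) \<le> r S}"

definition downward_closed :: "(nat ^ 'd) set \<Rightarrow> bool" where
  "downward_closed S \<longleftrightarrow> (\<forall>n\<in>S. \<forall>m\<le>n. m \<in> S)"

definition vfact :: "nat ^ 'd::finite \<Rightarrow> real" where
  "vfact n = (\<Prod>i\<in>UNIV. fact (n $ i))"

definition vpow :: "real ^ 'd::finite \<Rightarrow> nat ^ 'd \<Rightarrow> real" where
  "vpow l n = (\<Prod>i\<in>UNIV. (l $ i) ^ (n $ i))"

definition psd_on :: "'i set \<Rightarrow> ('i \<Rightarrow> 'i \<Rightarrow> real) \<Rightarrow> bool" where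
  "psd_on I M \<longleftrightarrow>
     (\<forall>i\<in>I. \<forall>j\<in>I. M i j = M j i) \<and>
     (\<forall>x :: 'i \<Rightarrow> real. 0 \<le> (\<Sum>i\<in>I. \<Sum>j\<in>I. x i * M i j * x j))"

definition ulc_weight :: "(nat ^ 'd::finite) pmf \<Rightarrow> nat ^ 'd \<Rightarrow> real" where
  "ulc_weight \<mu> n = vfact n * pmf \<mu> n"

definition up_dirs :: "(nat ^ 'd::finite) pmf \<Rightarrow> nat ^ 'd \<Rightarrow> 'd set" where
  "up_dirs \<mu> n = {i. n + axis i 1 \<in> set_pmf \<mu>}"

definition ULC :: "(nat ^ 'd::finite) pmf \<Rightarrow> bool" where
  "ULC \<mu> \<longleftrightarrow>
     downward_closed (set_pmf \<mu>) \<and>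
     (\<forall>n\<in>set_pmf \<mu>.
        psd_on (up_dirs \<mu> n)
          (\<lambda>i j. 1 - ulc_weight \<mu> n * ulc_weight \<mu> (n + axis i 1 + axis j 1)
                     / (ulc_weight \<mu> (n + axis i 1) * ulc_weight \<mu> (n + axis j 1))))"

definition polymatroid_pmf ::
    "('d::finite set \<Rightarrow> nat) \<Rightarrow> real ^ 'd \<Rightarrow> (nat ^ 'd) pmf" where
  "polymatroid_pmf r l =
     embed_pmf (\<lambda>n. if n \<in> discrete_polymatroid r
                    then (vpow l n / vfact n) / (\<Sum>m\<in>discrete_polymatroid r. vpow l m / vfact m)
                    else 0)"

lemma finite_discrete_polymatroid: "finite (discrete_polymatroid r)"
proof -
  have "n $ i \<le> r {i}" if "n \<in> discrete_polymatroid r" for n i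
    using that unfolding discrete_polymatroid_def by (auto dest!: spec[of _ "{i}"])
  then have "vec_nth ` discrete_polymatroid r \<subseteq> Pi\<^sub>E UNIV (\<lambda>i. {..r {i}})"
    by auto
  moreover have "finite (Pi\<^sub>E UNIV (\<lambda>i. {..r {i}}))"
    by (intro finite_PiE) auto
  ultimately have "finite (vec_nth ` discrete_polymatroid r)"
    by (rule finite_subset)
  then show ?thesis
    by (rule finite_imageD) (simp add: inj_on_def vec_nth_inject)
qed

text \<open>
  Since \<open>embed_pmf\<close> is unspecified on functions that are not probability mass functions, the
  following confirms that \<open>polymatroid_pmf r l\<close> really has the intended point masses.
\<close>

lemma pmf_polymatroid_pmf:
  assumes "\<And>i. l $ i > 0"
  shows "pmf (polymatroid_pmf r l) n =
     (if n \<in> discrete_polymatroid r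
      then (vpow l n / vfact n) / (\<Sum>m\<in>discrete_polymatroid r. vpow l m / vfact m)
      else 0)"
proof -
  define P where "P = discrete_polymatroid r"
  define w where "w m = vpow l m / vfact m" for m
  define f where "f m = (if m \<in> P then w m / (\<Sum>m\<in>P. w m) else 0)" for m
  have fin: "finite P"
    unfolding P_def by (rule finite_discrete_polymatroid)
  have wpos: "w m > 0" for m
    unfolding w_def vpow_def vfact_def using assms by (auto intro!: divide_pos_pos prod_pos)
  have "0 \<in> P"
    unfolding P_def discrete_polymatroid_def by simp
  then have Z: "(\<Sum>m\<in>P. w m) > 0"
    using fin wpos by (intro sum_pos) auto
  have nonneg: "f m \<ge> 0" for m
    unfolding f_def using Z wpos[of m] by simp
  have "(\<integral>\<^sup>+m. f m \<partial>count_space UNIV) = (\<Sum>m\<in>P. ennreal (f m))"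
    by (rule nn_integral_count_space'[OF fin]) (auto simp: f_def)
  also have "\<dots> = ennreal (\<Sum>m\<in>P. f m)"
    using nonneg by simp
  also have "(\<Sum>m\<in>P. f m) = 1"
    using Z by (simp add: f_def flip: sum_divide_distrib)
  finally have "pmf (embed_pmf f) n = f n"
    using nonneg by (intro pmf_embed_pmf) auto
  then show ?thesis
    unfolding polymatroid_pmf_def f_def w_def P_def .
qed

end

theory Submission
  imports Defs
begin

text \<open>
  On \<open>P\<^sub>r\<close> the weight \<open>n! \<mu>(n)\<close> is a constant times \<open>\<lambda>\<^sup>n\<close>, so the matrix at \<open>n\<close> is the
  0/1 matrix of the relation \<open>n + e\<^sub>i + e\<^sub>j \<notin> P\<^sub>r\<close> on the allowed directions.  This relation says
  that \<open>i\<close> and \<open>j\<close> lie in a common set of slack 1; by submodularity the union of two such sets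
  sharing an allowed direction again has slack 1, so the relation is symmetric and transitive and
  its matrix is a sum of all-ones blocks.
\<close>

text \<open>Elements not related to themselves give zero rows; the others split into classes, and
  the quadratic form is the sum over classes of the squared class sums of \<open>x\<close>. Summing
  over all \<open>k\<close> with weight \<open>1 / c k\<close> avoids choosing representatives,
  since each class is met once per member.\<close>

lemma psd_on_per:
  assumes fin: "finite I"
    and sym: "\<And>i j. i \<in> I \<Longrightarrow> j \<in> I \<Longrightarrow> R i j \<Longrightarrow> R j i"
    and trans: "\<And>i j k. i \<in> I \<Longrightarrow> j \<in> I \<Longrightarrow> k \<in> I \<Longrightarrow> R i j \<Longrightarrow> R j k \<Longrightarrow> R i k"
  shows "psd_on I (\<lambda>i j. of_bool (R i j))"
  unfolding psd_on_def
proof (intro conjI ballI allI)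
  fix i j assume "i \<in> I" "j \<in> I"
  then show "of_bool (R i j) = (of_bool (R j i) :: real)"
    using sym by (auto simp: of_bool_def)
next
  fix x :: "'a \<Rightarrow> real"
  define C where "C k = {j\<in>I. R k j}" for k
  \<comment> \<open>If \<open>C k\<close> is empty, \<open>c k\<close> is 0, but the numerators
    attached to \<open>k\<close> vanish as well.\<close>
  define c where "c k = real (card (C k))" for k
  have weight: "(\<Sum>k\<in>I. of_bool (R k i) * of_bool (R k j) / c k) = of_bool (R i j)"
    if "i \<in> I" "j \<in> I" for i j
  proof (cases "R i j")
    case True
    have "C k = C i" if "k \<in> C i" for k
      using that \<open>i \<in> I\<close> sym trans unfolding C_def by blast
    moreover have "R k i \<and> R k j \<longleftrightarrow> k \<in> C i" if "k \<in> I" for k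
      using that \<open>i \<in> I\<close> \<open>j \<in> I\<close> True sym trans unfolding C_def by blast
    ultimately have "(\<Sum>k\<in>I. of_bool (R k i) * of_bool (R k j) / c k)
        = (\<Sum>k\<in>I. if k \<in> C i then 1 / c i else 0)"
      by (intro sum.cong) (auto simp: c_def)
    also have "\<dots> = (\<Sum>k\<in>C i. 1 / c i)"
      using fin by (simp add: sum.inter_filter[symmetric] C_def)
    also have "\<dots> = 1"
      \<comment> \<open>\<open>j\<close> lies in \<open>C i\<close>, so \<open>c i\<close> is
        nonzero and the \<open>c i\<close> equal terms add up to 1.\<close>
      using True \<open>j \<in> I\<close> fin by (auto simp: c_def C_def card_eq_0_iff)
    finally show ?thesis
      using True by simp
  next
    case False
    then have "\<not> (R k i \<and> R k j)" if "k \<in> I" for k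
      using that \<open>i \<in> I\<close> \<open>j \<in> I\<close> sym trans by blast
    then show ?thesis
      using False by (auto intro!: sum.neutral)
  qed
  have "(\<Sum>i\<in>I. \<Sum>j\<in>I. x i * of_bool (R i j) * x j)
      = (\<Sum>i\<in>I. \<Sum>j\<in>I. \<Sum>k\<in>I. x i * (of_bool (R k i) * of_bool (R k j) / c k) * x j)"
    by (intro sum.cong refl) (simp only: weight flip: sum_distrib_left sum_distrib_right)
  also have "\<dots> = (\<Sum>i\<in>I. \<Sum>k\<in>I. \<Sum>j\<in>I. x i * (of_bool (R k i) * of_bool (R k j) / c k) * x j)"
    by (intro sum.cong refl sum.swap)
  also have "\<dots> = (\<Sum>k\<in>I. \<Sum>i\<in>I. \<Sum>j\<in>I. x i * (of_bool (R k i) * of_bool (R k j) / c k) * x j)"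
    by (rule sum.swap)
  \<comment> \<open>For fixed \<open>k\<close> the coefficient is a product of a factor in
    \<open>i\<close> and a factor in \<open>j\<close>, so the double sum is a square.\<close>
  also have "\<dots> = (\<Sum>k\<in>I. (\<Sum>i\<in>I. of_bool (R k i) * x i)\<^sup>2 / c k)"
    by (intro sum.cong refl)
       (simp add: power2_eq_square sum_product sum_divide_distrib mult_ac)
  also have "\<dots> \<ge> 0"
    by (intro sum_nonneg divide_nonneg_nonneg) (auto simp: c_def)
  finally show "0 \<le> (\<Sum>i\<in>I. \<Sum>j\<in>I. x i * of_bool (R i j) * x j)" .
qed

lemma sum_add_axis:
  fixes n :: "nat ^ 'd::finite"
  shows "(\<Sum>k\<in>S. (n + axis i 1) $ k) = (\<Sum>k\<in>S. n $ k) + of_bool (i \<in> S)"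
proof -
  have "(\<Sum>k\<in>S. axis i (1::nat) $ k) = (\<Sum>k\<in>S. if i = k then 1 else 0)"
    by (intro sum.cong) (auto simp: axis_def)
  then show ?thesis
    by (simp add: sum.distrib)
qed

lemma add_axis_in_discrete_polymatroid_iff:
  "n + axis i 1 \<in> discrete_polymatroid r \<longleftrightarrow> (\<forall>S. (\<Sum>k\<in>S. n $ k) + of_bool (i \<in> S) \<le> r S)"
  unfolding discrete_polymatroid_def mem_Collect_eq sum_add_axis ..

text \<open>Feasibility of each single step leaves slack at least 1 on every set containing
  \<open>i\<close> or \<open>j\<close>, so the double step can only violate a set that contains both
  and has slack exactly 1. The case \<open>i = j\<close> is included and governs the diagonal
  entries.\<close>

lemma discrete_polymatroid_blocked_iff:
  assumes "n + axis i 1 \<in> discrete_polymatroid r" "n + axis j 1 \<in> discrete_polymatroid r"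
  shows "n + axis i 1 + axis j 1 \<notin> discrete_polymatroid r \<longleftrightarrow>
    (\<exists>S. i \<in> S \<and> j \<in> S \<and> r S = (\<Sum>k\<in>S. n $ k) + 1)"
proof -
  have le: "(\<Sum>k\<in>S. n $ k) + of_bool (i \<in> S) \<le> r S" "(\<Sum>k\<in>S. n $ k) + of_bool (j \<in> S) \<le> r S" for S
    using assms unfolding add_axis_in_discrete_polymatroid_iff by blast+
  have "r S < (\<Sum>k\<in>S. n $ k) + of_bool (i \<in> S) + of_bool (j \<in> S) \<longleftrightarrow>
      i \<in> S \<and> j \<in> S \<and> r S = (\<Sum>k\<in>S. n $ k) + 1" for S
    using le[of S] by (cases "i \<in> S"; cases "j \<in> S") auto
  then show ?thesis
    unfolding add_axis_in_discrete_polymatroid_iff sum_add_axis by (simp add: not_le)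
qed

lemma discrete_polymatroid_blocked_trans:
  assumes r: "polymatroid_rank r"
    and i: "n + axis i 1 \<in> discrete_polymatroid r"
    and j: "n + axis j 1 \<in> discrete_polymatroid r"
    and k: "n + axis k 1 \<in> discrete_polymatroid r"
    and ij: "n + axis i 1 + axis j 1 \<notin> discrete_polymatroid r"
    and jk: "n + axis j 1 + axis k 1 \<notin> discrete_polymatroid r"
  shows "n + axis i 1 + axis k 1 \<notin> discrete_polymatroid r"
proof -
  obtain S where S: "i \<in> S" "j \<in> S" "r S = (\<Sum>k\<in>S. n $ k) + 1"
    using ij discrete_polymatroid_blocked_iff[OF i j] by blast
  obtain T where T: "j \<in> T" "k \<in> T" "r T = (\<Sum>k\<in>T. n $ k) + 1"
    using jk discrete_polymatroid_blocked_iff[OF j k] by blast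
  \<comment> \<open>Since the sum of \<open>n\<close> over a set is modular, the slack is
    submodular: it totals at most 1 + 1 on the union and the intersection.\<close>
  have "r (S \<union> T) + r (S \<inter> T) \<le> r S + r T"
    using r unfolding polymatroid_rank_def by blast
  moreover have "(\<Sum>k\<in>S \<union> T. n $ k) + (\<Sum>k\<in>S \<inter> T. n $ k) = (\<Sum>k\<in>S. n $ k) + (\<Sum>k\<in>T. n $ k)"
    by (rule sum.union_inter) auto
  \<comment> \<open>The shared direction \<open>j\<close> forces slack at least 1 on the
    intersection, leaving at most 1 for the union; \<open>i\<close> forces at least 1 there.\<close>
  moreover have "(\<Sum>k\<in>S \<inter> T. n $ k) + of_bool (j \<in> S \<inter> T) \<le> r (S \<inter> T)"
    using j unfolding add_axis_in_discrete_polymatroid_iff by blast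
  moreover have "(\<Sum>k\<in>S \<union> T. n $ k) + of_bool (i \<in> S \<union> T) \<le> r (S \<union> T)"
    using i unfolding add_axis_in_discrete_polymatroid_iff by blast
  ultimately have "r (S \<union> T) = (\<Sum>k\<in>S \<union> T. n $ k) + 1"
    using S T by simp
  then show ?thesis
    using S T discrete_polymatroid_blocked_iff[OF i k] by blast
qed

lemma downward_closed_discrete_polymatroid: "downward_closed (discrete_polymatroid r)"
  unfolding downward_closed_def
proof (intro ballI allI impI)
  fix n m :: "nat ^ 'a"
  assume n: "n \<in> discrete_polymatroid r" and "m \<le> n"
  then have "(\<Sum>i\<in>S. m $ i) \<le> (\<Sum>i\<in>S. n $ i)" for S
    by (intro sum_mono) (simp add: less_eq_vec_def)
  then show "m \<in> discrete_polymatroid r"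
    using n unfolding discrete_polymatroid_def by (blast intro: order_trans)
qed

lemma vpow_add: "vpow l (m + n) = vpow l m * vpow l n"
  by (simp add: vpow_def power_add prod.distrib)

theorem theorem6p2:
  fixes r :: "'d::finite set \<Rightarrow> nat" and l :: "real ^ 'd"
  assumes "polymatroid_rank r"
    and "\<And>i. l $ i > 0"
  shows "ULC (polymatroid_pmf r l)"
proof -
  define P where "P = discrete_polymatroid r"
  define Z where "Z = (\<Sum>m\<in>P. vpow l m / vfact m)"
  have vpow_pos: "vpow l m > 0" for m
    using assms(2) by (simp add: vpow_def prod_pos)
  have vfact_pos: "vfact m > 0" for m :: "nat ^ 'd"
    by (simp add: vfact_def prod_pos)
  have "0 \<in> P"
    by (simp add: P_def discrete_polymatroid_def)
  then have Z: "Z > 0"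
    unfolding Z_def P_def using finite_discrete_polymatroid vpow_pos vfact_pos
    by (intro sum_pos) auto
  have pmf: "pmf (polymatroid_pmf r l) m = (if m \<in> P then vpow l m / vfact m / Z else 0)" for m
    unfolding P_def Z_def using assms(2) by (rule pmf_polymatroid_pmf)
  have set: "set_pmf (polymatroid_pmf r l) = P"
    using Z vpow_pos vfact_pos by (auto simp: set_pmf_iff pmf less_imp_neq[symmetric] split: if_splits)
  have weight: "ulc_weight (polymatroid_pmf r l) m = (if m \<in> P then vpow l m / Z else 0)" for m
    using vfact_pos[of m] by (simp add: ulc_weight_def pmf)
  have "psd_on (up_dirs (polymatroid_pmf r l) n)
      (\<lambda>i j. 1 - ulc_weight (polymatroid_pmf r l) n
          * ulc_weight (polymatroid_pmf r l) (n + axis i 1 + axis j 1)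
        / (ulc_weight (polymatroid_pmf r l) (n + axis i 1)
          * ulc_weight (polymatroid_pmf r l) (n + axis j 1)))"
    (is "psd_on ?I ?M") if "n \<in> P" for n
  proof -
    define R where "R i j \<longleftrightarrow> n + axis i 1 + axis j 1 \<notin> P" for i j
    have I: "i \<in> ?I \<longleftrightarrow> n + axis i 1 \<in> P" for i
      by (simp add: up_dirs_def set)
    have "psd_on ?I (\<lambda>i j. of_bool (R i j))"
    proof (rule psd_on_per)
      show "R j i" if "R i j" for i j
        using that by (simp add: R_def add_ac)
      show "R i k" if "i \<in> ?I" "j \<in> ?I" "k \<in> ?I" "R i j" "R j k" for i j k
        using discrete_polymatroid_blocked_trans[OF assms(1)] that
        unfolding I R_def P_def by blast
    qed simp
    moreover have "?M i j = of_bool (R i j)" if "i \<in> ?I" "j \<in> ?I" for i j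
    proof -
      \<comment> \<open>The powers of \<open>l\<close> and the factors \<open>Z\<close> cancel, so
        the quotient is 1 when the double step stays in \<open>P\<close>, and 0 when it leaves
        \<open>P\<close> because the weight there is 0.\<close>
      have "vpow l n * vpow l (n + axis i 1 + axis j 1)
          = vpow l (n + axis i 1) * vpow l (n + axis j 1)"
        by (simp add: vpow_add)
      then show ?thesis
        using that \<open>n \<in> P\<close> Z vpow_pos[of "n + axis i 1"] vpow_pos[of "n + axis j 1"]
        unfolding I by (simp add: weight R_def)
    qed
    \<comment> \<open>Only entries with both indices in \<open>?I\<close> enter
      \<open>psd_on\<close>, so agreement there suffices.\<close>
    ultimately show ?thesis
      by (simp add: psd_on_def cong: sum.cong)
  qed
  then show ?thesis
    unfolding ULC_def set using downward_closed_discrete_polymatroid by (auto simp: P_def)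
qed

end
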